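(* Let $L$ be a finite-dimensional $\omega$-Lie algebra over $K$ which is not a Lie algebra. Then one of the following holds: (i) $\dim L = 3$. (ii) $L$ has a Lie subalgebra $M$ of codimension $1$ which has one of the following structures: (a) $M = A \oplus Kx$ (as a vector space), where $A$ is abelian and $\operatorname{ad} x$ maps $A$ to $A$ and acts on it as an arbitrary linear map; (b) $M$ is the direct sum of an abelian Lie algebra $A$ and the two-dimensional nonabelian Lie algebra $\langle x,y \mid [x,y]=y\rangle$; (c) $M = A \oplus Kx \oplus Ky$ (as a vector space), where $A$ is abelian, $\operatorname{ad} x$ acts on $A$ as the identity map, $\operatorname{ad} y$ maps $A$ to $A$ and acts on it as an arbitrary linear map, and $[x,y]\in A$; (d) $M = A \oplus Kx \oplus Ky$ (as a vector space), where $A$ is abelian, $\operatorname{ad} x$ acts on $A$ as the identity map, $\operatorname{ad} y$ acts on $A$ as the zero map, and $[x,y] = a + \sigma y$ for some $a\in A$ and $\sigma\in K$, $\sigma\neq 0$. (iii) $\operatorname{Ker}\omega$ is an almost abelian Lie algebra of codimension $2$ in $L$, with its abelian part acting nilpotently on $L$. In all the cases, $L$ has an abelian subalgebra of codimension $\le 3$.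
   Context: $K$ is a field of characteristic different from $2$ and $3$. An $\omega$-Lie algebra is an anticommutative algebra $L$ over $K$ with multiplication $[\cdot,\cdot]$ together with a bilinear form $\omega: L\times L\to K$ (necessarily skew-symmetric) such that for all $x,y,z\in L$ $$[[x,y],z]+[[z,x],y]+[[y,z],x] = \omega(x,y)z+\omega(z,x)y+\omega(y,z)x .$$ A Lie algebra is an anticommutative algebra satisfying the Jacobi identity; a Lie subalgebra of $L$ is a subalgebra which is a Lie algebra under the bracket of $L$. $\operatorname{Ker}\omega = \{x\in L : \omega(x,L)=0\}$. For $h \in L$, $\operatorname{ad} h$ denotes right multiplication, $(\operatorname{ad} h)(x) = [x,h]$. An abelian subalgebra is one with zero multiplication. An almost abelian Lie algebra is a semidirect sum $A\oplus Kx$ where $A$ is an abelian Lie algebra (an ideal) and $\operatorname{ad} x$ acts on $A$ as the identity map; $A$ is called its abelian part. That the abelian part $H$ acts nilpotently on $L$ means that $\operatorname{ad} h: L\to L$ is nilpotent for each $h\in H$. *)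

theory Defs
  imports Complex_Main
begin

text \<open>
  An algebra is carried by a whole type, with scalar multiplication \<open>scale\<close> and
  bracket \<open>br\<close>; no topology or norm is involved. Subalgebras and ideals are subsets.
\<close>

locale anticommutative_algebra = vector_space scale
  for scale :: "'k::field \<Rightarrow> 'l::ab_group_add \<Rightarrow> 'l" +
  fixes br :: "'l \<Rightarrow> 'l \<Rightarrow> 'l"
  assumes linear_br_right: "Vector_Spaces.linear scale scale (\<lambda>y. br x y)"
    and linear_br_left: "Vector_Spaces.linear scale scale (\<lambda>x. br x y)"
    and anticommutative: "br x y = - br y x"
begin

definition jacobian :: "'l \<Rightarrow> 'l \<Rightarrow> 'l \<Rightarrow> 'l" where
  "jacobian x y z = br (br x y) z + br (br z x) y + br (br y z) x"

text \<open>Right multiplication, so \<open>ad x\<close> acting as the identity on \<open>A\<close> means \<open>br a x = a\<close>.\<close>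

definition ad :: "'l \<Rightarrow> 'l \<Rightarrow> 'l" where
  "ad h x = br x h"

definition nilpotent_map :: "('l \<Rightarrow> 'l) \<Rightarrow> bool" where
  "nilpotent_map f \<longleftrightarrow> (\<exists>n. \<forall>x. (f ^^ n) x = 0)"

definition subalgebra :: "'l set \<Rightarrow> bool" where
  "subalgebra M \<longleftrightarrow> subspace M \<and> (\<forall>x\<in>M. \<forall>y\<in>M. br x y \<in> M)"

definition lie_subalgebra :: "'l set \<Rightarrow> bool" where
  "lie_subalgebra M \<longleftrightarrow> subalgebra M \<and> (\<forall>x\<in>M. \<forall>y\<in>M. \<forall>z\<in>M. jacobian x y z = 0)"

definition abelian_subalgebra :: "'l set \<Rightarrow> bool" where
  "abelian_subalgebra A \<longleftrightarrow> subalgebra A \<and> (\<forall>x\<in>A. \<forall>y\<in>A. br x y = 0)"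

definition ideal_of :: "'l set \<Rightarrow> 'l set \<Rightarrow> bool" where
  "ideal_of A M \<longleftrightarrow> subspace A \<and> A \<subseteq> M \<and> (\<forall>a\<in>A. \<forall>m\<in>M. br a m \<in> A)"

text \<open>Internal direct sum of subspaces.\<close>

definition direct_sum :: "'l set \<Rightarrow> 'l set \<Rightarrow> 'l set \<Rightarrow> bool" where
  "direct_sum M U V \<longleftrightarrow> subspace U \<and> subspace V \<and>
     M = {u + v |u v. u \<in> U \<and> v \<in> V} \<and> U \<inter> V = {0}"

text \<open>
  \<open>decomposes M A [x\<^sub>1, \<dots>, x\<^sub>n]\<close> says that \<open>M = A \<oplus> K x\<^sub>1 \<oplus> \<dots> \<oplus> K x\<^sub>n\<close> as a vector space,
  every \<open>K x\<^sub>i\<close> being one-dimensional. The subspace \<open>A\<close> may be zero.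
\<close>

definition decomposes :: "'l set \<Rightarrow> 'l set \<Rightarrow> 'l list \<Rightarrow> bool" where
  "decomposes M A xs \<longleftrightarrow>
     distinct xs \<and> independent (set xs) \<and> direct_sum M A (span (set xs))"

definition structure_a :: "'l set \<Rightarrow> bool" where
  "structure_a M \<longleftrightarrow> (\<exists>A x. decomposes M A [x] \<and> abelian_subalgebra A \<and>
     (\<forall>a\<in>A. ad x a \<in> A))"

definition structure_b :: "'l set \<Rightarrow> bool" where
  "structure_b M \<longleftrightarrow> (\<exists>A x y. decomposes M A [x, y] \<and> abelian_subalgebra A \<and>
     br x y = y \<and> (\<forall>a\<in>A. \<forall>b\<in>span {x, y}. br a b = 0))"

definition structure_c :: "'l set \<Rightarrow> bool" where
  "structure_c M \<longleftrightarrow> (\<exists>A x y. decomposes M A [x, y] \<and> abelian_subalgebra A \<and>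
     (\<forall>a\<in>A. ad x a = a) \<and> (\<forall>a\<in>A. ad y a \<in> A) \<and> br x y \<in> A)"

definition structure_d :: "'l set \<Rightarrow> bool" where
  "structure_d M \<longleftrightarrow> (\<exists>A x y. decomposes M A [x, y] \<and> abelian_subalgebra A \<and>
     (\<forall>a\<in>A. ad x a = a) \<and> (\<forall>a\<in>A. ad y a = 0) \<and>
     (\<exists>a\<in>A. \<exists>\<sigma>. \<sigma> \<noteq> 0 \<and> br x y = a + scale \<sigma> y))"

definition almost_abelian :: "'l set \<Rightarrow> 'l set \<Rightarrow> bool" where
  "almost_abelian M A \<longleftrightarrow> lie_subalgebra M \<and> abelian_subalgebra A \<and> ideal_of A M \<and>
     (\<exists>x. decomposes M A [x] \<and> (\<forall>a\<in>A. ad x a = a))"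

end

locale lie_algebra = anticommutative_algebra +
  assumes jacobi: "jacobian x y z = 0"

text \<open>Skew-symmetry of \<open>\<omega>\<close> is a consequence of the axioms, hence not assumed.\<close>

locale omega_lie_algebra = anticommutative_algebra scale br
  for scale :: "'k::field \<Rightarrow> 'l::ab_group_add \<Rightarrow> 'l" and br :: "'l \<Rightarrow> 'l \<Rightarrow> 'l" +
  fixes \<omega> :: "'l \<Rightarrow> 'l \<Rightarrow> 'k"
  assumes linear_omega_right: "Vector_Spaces.linear scale (*) (\<lambda>y. \<omega> x y)"
    and linear_omega_left: "Vector_Spaces.linear scale (*) (\<lambda>x. \<omega> x y)"
    and omega_jacobi: "jacobian x y z = scale (\<omega> x y) z + scale (\<omega> z x) y + scale (\<omega> y z) x"

definition form_kernel :: "('l \<Rightarrow> 'l \<Rightarrow> 'k::zero) \<Rightarrow> 'l set" where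
  "form_kernel \<omega> = {x. \<forall>y. \<omega> x y = 0}"

end

theory Submission
  imports Defs
begin

text \<open>
  The heart of the matter is that \<open>\<omega>\<close> has rank 2. In every anticommutative algebra the Jacobians
  of four elements are linked by an identity (\<open>jacobian_four\<close>). When Jacobians are given by
  \<open>\<omega>\<close>, it becomes \<open>omega_wedge_bracket\<close>: the exterior product of \<open>\<omega>\<close> with the bracket equals that
  of a 3-form \<open>cyc\<close> with the identity map. Hence, if \<open>\<omega> x y = 1\<close>, the bracket of two vectors
  orthogonal to \<open>x\<close> and \<open>y\<close> lies in an explicitly known span, up to a multiple of \<open>[x, y]\<close>.
  Three mutually orthogonal hyperbolic pairs then determine all brackets among
  themselves, in a way that contradicts \<open>J(x, y, z) = z\<close>
  (\<open>no_symplectic_six\<close>). Two such pairs act by scalars on each vector of \<open>Ker \<omega>\<close>, which leaves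
  no room for a nonzero vector there (\<open>symplectic_four_no_kernel\<close>), and in dimension 4 the traces
  of the left multiplications give a contradiction (\<open>symplectic_four_degenerate\<close>). So rank at
  least 4 is impossible (\<open>orthogonal_complement_in_kernel\<close>).

  Since \<open>L\<close> is not a Lie algebra, \<open>\<omega> x y = 1\<close> for some \<open>x\<close> and \<open>y\<close>, and \<open>L = Z \<oplus> Kx \<oplus> Ky\<close> with
  \<open>Z = Ker \<omega>\<close>. The same identity gives \<open>[z, t] = f(z) t - f(t) z\<close> on \<open>Z\<close>, where \<open>f(z)\<close> is
  the trace of \<open>z\<close> acting on the two-dimensional space \<open>L/Z\<close>; so \<open>Z\<close> is a Lie algebra, and it is
  abelian or almost abelian.

  If \<open>f \<noteq> 0\<close>, then \<open>H = ker f\<close> is the abelian part. An element \<open>z\<close> of \<open>Z\<close> with \<open>f(z) \<noteq> 0\<close>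
  has every \<open>h\<close> in \<open>H\<close> as an eigenvector, and this forces \<open>h\<close> to act on \<open>L/Z\<close> with
  square zero; so \<open>ad h\<close> is nilpotent (\<open>ad_nilpotent\<close>) and alternative (iii) holds.

  If \<open>f = 0\<close>, then \<open>Z\<close> is abelian and acts on \<open>L/Z\<close> by commuting traceless \<open>2 \<times> 2\<close> matrices, which
  are all proportional. When these are singular, they kill a common vector \<open>v\<close>, and \<open>Z \<oplus> Kv\<close> has
  structure (a). When one of them is invertible, an element of \<open>Z\<close> acting by the zero matrix
  annihilates all of \<open>L\<close>; since \<open>J(x, y, t) = t\<close> for \<open>t\<close> in \<open>Z\<close>, that element is 0. As the matrices
  are proportional, \<open>dim Z = 1\<close> and \<open>dim L = 3\<close> (\<open>abelian_kernel_dichotomy\<close>).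

  The required abelian subalgebra is \<open>Z\<close> or \<open>H\<close>.
\<close>

section \<open>Linear algebra and anticommutative algebras\<close>

context vector_space
begin

lemma scale_two: "scale 2 v = v + v"
  using scale_left_distrib[of 1 1 v] by simp

lemma dim_insert_finitely_spanned:
  assumes "\<exists>B. finite B \<and> span B = UNIV" and "v \<notin> span S"
  shows "dim (insert v S) = dim S + 1"
proof -
  obtain B where B: "finite B" "span B = UNIV" using assms(1) by blast
  obtain C where C: "C \<subseteq> B" "independent C" "B \<subseteq> span C"
    using maximal_independent_subset[of B] by blast
  interpret finite_dimensional_vector_space scale C
    using B C span_mono[of B "span C"] finite_subset[of C B] by unfold_locales (auto simp: span_span)
  show ?thesis using assms(2) by (simp add: dim_insert)
qed

end

context anticommutative_algebra
begin

lemma decomposes_insert: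
  assumes "subspace A" "v \<notin> A"
  shows "decomposes (span (insert v A)) A [v]"
proof -
  have "v \<noteq> 0" using assms subspace_0 by blast
  moreover have "span (insert v A) = {u + w |u w. u \<in> A \<and> w \<in> span {v}}"
    using span_Un[of A "{v}"] assms(1) by (simp add: span_eq_iff[THEN iffD2])
  moreover have "A \<inter> span {v} = {0}"
  proof -
    have "k = 0" if "scale k v \<in> A" for k
      using that assms subspace_scale[OF assms(1) that, of "inverse k"] by (cases "k = 0") auto
    then show ?thesis using assms(1) subspace_0 by (fastforce simp: span_singleton)
  qed
  ultimately show ?thesis using assms(1) by (simp add: decomposes_def direct_sum_def)
qed


lemma
  shows br_add_right: "br x (y + z) = br x y + br x z"
    and br_add_left: "br (x + y) z = br x z + br y z"
    and br_scale_right: "br x (scale c y) = scale c (br x y)"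
    and br_scale_left: "br (scale c x) y = scale c (br x y)"
  using linear_br_right[of x] linear_br_left[of z] linear_br_left[of y]
  by (simp_all add: Vector_Spaces.linear_iff)

lemma
  shows br_minus_right: "br x (- y) = - br x y"
    and br_minus_left: "br (- x) y = - br x y"
    and br_zero_right: "br x 0 = 0"
    and br_zero_left: "br 0 y = 0"
  using br_scale_right[of x "-1" y] br_scale_left[of "-1" x y]
    br_scale_right[of x 0 0] br_scale_left[of 0 0 y] by simp_all

lemma
  shows br_diff_right: "br x (y - z) = br x y - br x z"
    and br_diff_left: "br (x - y) z = br x z - br y z"
  using br_add_right[of x y "-z"] br_add_left[of x "-y" z]
  by (simp_all add: br_minus_right br_minus_left)

lemmas br_simps = br_add_right br_add_left br_scale_right br_scale_left
  br_minus_right br_minus_left br_zero_right br_zero_left br_diff_right br_diff_left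

text \<open>
  Both sides are signed sums of products of four factors, alternating in \<open>x, y, z, t\<close>. On the right, the
  products of the shape \<open>[[x, y], [z, t]]\<close> cancel in pairs, and those of the shape
  \<open>[[[x, y], z], t]\<close> match the left-hand side.
\<close>
lemma jacobian_four:
  "br (jacobian x y z) t - br (jacobian x y t) z + br (jacobian x z t) y - br (jacobian y z t) x
   = jacobian (br x y) z t - jacobian (br x z) y t + jacobian (br x t) y z
     + jacobian (br y z) x t - jacobian (br y t) x z + jacobian (br z t) x y"
proof -
  note flip = anticommutative[of z x] anticommutative[of t x] anticommutative[of t y]
    anticommutative[of y "br _ _"] anticommutative[of x "br _ _"]
    anticommutative[of z "br _ _"] anticommutative[of t "br _ _"]
    anticommutative[of "br z t" "br x y"] anticommutative[of "br y t" "br x z"]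
    anticommutative[of "br y z" "br x t"]
  show ?thesis
    unfolding jacobian_def by (simp add: br_simps flip)
qed

end

section \<open>The four-element identity of an omega-Lie algebra\<close>

locale omega_lie_algebra_char_not_2_3 = omega_lie_algebra +
  assumes two_neq_zero: "(2::'a) \<noteq> 0" and three_neq_zero: "(3::'a) \<noteq> 0"
begin

lemma
  shows omega_add_right: "\<omega> x (y + z) = \<omega> x y + \<omega> x z"
    and omega_add_left: "\<omega> (x + y) z = \<omega> x z + \<omega> y z"
    and omega_scale_right: "\<omega> x (scale c y) = c * \<omega> x y"
    and omega_scale_left: "\<omega> (scale c x) y = c * \<omega> x y"
  using linear_omega_right[of x] linear_omega_left[of z] linear_omega_left[of y]
  by (simp_all add: Vector_Spaces.linear_iff)

lemma
  shows omega_minus_right: "\<omega> x (- y) = - \<omega> x y"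
    and omega_minus_left: "\<omega> (- x) y = - \<omega> x y"
    and omega_zero_right: "\<omega> x 0 = 0"
    and omega_zero_left: "\<omega> 0 y = 0"
  using omega_scale_right[of x "-1" y] omega_scale_left[of "-1" x y]
    omega_scale_right[of x 0 0] omega_scale_left[of 0 0 y] by simp_all

lemma
  shows omega_diff_right: "\<omega> x (y - z) = \<omega> x y - \<omega> x z"
    and omega_diff_left: "\<omega> (x - y) z = \<omega> x z - \<omega> y z"
  using omega_add_right[of x y "-z"] omega_add_left[of x "-y" z]
  by (simp_all add: omega_minus_right omega_minus_left)

lemmas omega_simps = omega_add_right omega_add_left omega_scale_right omega_scale_left
  omega_minus_right omega_minus_left omega_zero_right omega_zero_left omega_diff_right omega_diff_left

lemma br_self: "br x x = 0"
proof -
  have "scale 2 (br x x) = br x x + br x x" by (rule scale_two)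
  also have "\<dots> = 0" using anticommutative[of x x] by (metis add.right_inverse)
  finally show ?thesis using two_neq_zero by simp
qed

text \<open>
  \<open>J(x, x, x) = 0\<close> by anticommutativity, while the form side is \<open>3 \<omega>(x, x) x\<close>.
\<close>
lemma omega_self: "\<omega> x x = 0"
proof (cases "x = 0")
  case False
  have "jacobian x x x = 0" by (simp add: jacobian_def br_self br_simps)
  then have "scale (3 * \<omega> x x) x = 0"
    using omega_jacobi[of x x x] by (simp flip: scale_left_distrib)
  then show ?thesis using False three_neq_zero by simp
qed (simp add: omega_simps)

lemma omega_skew: "\<omega> y x = - \<omega> x y"
proof -
  have "\<omega> y x + \<omega> x y = \<omega> (x + y) (x + y)"
    unfolding omega_add_left omega_add_right by (simp add: omega_self)
  then show ?thesis by (simp add: omega_self eq_neg_iff_add_eq_0)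
qed

text \<open>The Chevalley-Eilenberg differential of the 2-form \<open>\<omega>\<close>, up to sign; it is an alternating 3-form.\<close>
definition cyc :: "'b \<Rightarrow> 'b \<Rightarrow> 'b \<Rightarrow> 'a" where
  "cyc x y z = \<omega> (br x y) z + \<omega> (br z x) y + \<omega> (br y z) x"

lemma cyc_rotate: "cyc x y z = cyc y z x"
  by (simp add: cyc_def)

lemma cyc_swap: "cyc y x z = - cyc x y z"
  unfolding cyc_def using anticommutative[of y x] anticommutative[of z y] anticommutative[of x z]
  by (simp add: omega_simps)

lemma cyc_minus: "cyc x y (- z) = - cyc x y z"
  by (simp add: cyc_def omega_simps br_simps)

text \<open>
  This is \<open>jacobian_four\<close> after both sides are expressed through \<open>\<omega>\<close>. Each product
  \<open>\<omega>(x, y) [z, t]\<close> occurs twice on the left of \<open>jacobian_four\<close> and once on its right, so one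
  copy survives.
\<close>
lemma omega_wedge_bracket:
  "scale (\<omega> x y) (br z t) + scale (\<omega> z t) (br x y) + scale (\<omega> y z) (br x t)
   + scale (\<omega> x t) (br y z) - scale (\<omega> x z) (br y t) - scale (\<omega> y t) (br x z)
   = scale (cyc x y z) t - scale (cyc x y t) z + scale (cyc x z t) y - scale (cyc y z t) x"
proof -
  have *: "br t z = - br z t" "br t x = - br x t" "br t y = - br y t"
    "br z y = - br y z" "br z x = - br x z" "br y x = - br x y"
    by (rule anticommutative)+
  have **: "\<omega> t z = - \<omega> z t" "\<omega> t x = - \<omega> x t" "\<omega> t y = - \<omega> y t"
    "\<omega> z y = - \<omega> y z" "\<omega> z x = - \<omega> x z" "\<omega> y x = - \<omega> x y"
    "\<And>a b c. \<omega> a (br b c) = - \<omega> (br b c) a"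
    by (rule omega_skew)+
  show ?thesis
    using jacobian_four[of x y z t]
    unfolding omega_jacobi cyc_def
    by (simp add: br_simps omega_simps * ** algebra_simps)
qed

text \<open>
  With a hyperbolic pair \<open>x, y\<close> and two vectors orthogonal to it, four of the six
  products in \<open>omega_wedge_bracket\<close> drop out.
\<close>
lemma bracket_on_orthogonal_complement:
  assumes "\<omega> x y = 1" "\<omega> x z = 0" "\<omega> x t = 0" "\<omega> y z = 0" "\<omega> y t = 0"
  shows "br z t = scale (cyc x y z) t - scale (cyc x y t) z + scale (cyc x z t) y
           - scale (cyc y z t) x - scale (\<omega> z t) (br x y)"
  using omega_wedge_bracket[of x y z t] assms by (simp add: algebra_simps)

section \<open>Vectors orthogonal to two hyperbolic pairs\<close>

definition symplectic_four :: "'b \<Rightarrow> 'b \<Rightarrow> 'b \<Rightarrow> 'b \<Rightarrow> bool" where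
  "symplectic_four x y z t \<longleftrightarrow> \<omega> x y = 1 \<and> \<omega> z t = 1 \<and>
     \<omega> x z = 0 \<and> \<omega> x t = 0 \<and> \<omega> y z = 0 \<and> \<omega> y t = 0"

lemma omega_symplectic_four:
  assumes "symplectic_four x y z t"
  shows "\<omega> x y = 1" "\<omega> y x = - 1" "\<omega> z t = 1" "\<omega> t z = - 1"
    "\<omega> x z = 0" "\<omega> z x = 0" "\<omega> x t = 0" "\<omega> t x = 0"
    "\<omega> y z = 0" "\<omega> z y = 0" "\<omega> y t = 0" "\<omega> t y = 0"
  using assms omega_skew[of y x] omega_skew[of t z] omega_skew[of z x] omega_skew[of t x]
    omega_skew[of z y] omega_skew[of t y]
  by (simp_all add: symplectic_four_def)

lemma
  assumes "symplectic_four x y z t"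
  shows symplectic_four_swap: "symplectic_four z t x y"
    and symplectic_four_rotate_left: "symplectic_four y (- x) z t"
    and symplectic_four_rotate_right: "symplectic_four x y t (- z)"
  using omega_symplectic_four[OF assms] by (simp_all add: symplectic_four_def omega_simps)

text \<open>
  A vector \<open>u\<close> orthogonal to two hyperbolic pairs can be bracketed with the vectors of one pair
  through \<open>bracket_on_orthogonal_complement\<close> applied to the other pair. The resulting
  brackets are again expressed through \<open>cyc\<close>; substituting them into the definition of \<open>cyc\<close>
  yields linear equations for its values. For \<open>u\<close> in \<open>Ker \<omega>\<close> they
  make \<open>cyc\<close> vanish at \<open>u\<close> and two of the four vectors, as 3 is invertible.
\<close>
lemma
  assumes four: "symplectic_four x y z t"
    and u: "\<omega> x u = 0" "\<omega> y u = 0" "\<omega> z u = 0" "\<omega> t u = 0"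
  shows cyc_hyperbolic_pairs: "cyc z t u = - cyc x y u"
    and cyc_hyperbolic_pair: "3 * cyc x y u = \<omega> (br x y) u"
    and cyc_across_pairs: "3 * cyc x z u = \<omega> (br x z) u"
proof -
  have \<omega>: "\<omega> x y = 1" "\<omega> y x = - 1" "\<omega> z t = 1" "\<omega> t z = - 1"
    "\<omega> x z = 0" "\<omega> z x = 0" "\<omega> x t = 0" "\<omega> t x = 0"
    "\<omega> y z = 0" "\<omega> z y = 0" "\<omega> y t = 0" "\<omega> t y = 0"
    "\<omega> u x = 0" "\<omega> u y = 0" "\<omega> u z = 0" "\<omega> u t = 0"
    using u omega_symplectic_four[OF four] omega_skew[of u x]
      omega_skew[of u y] omega_skew[of u z] omega_skew[of u t]
    by simp_all
  note [simp] = \<omega> u omega_self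
  have zu: "br z u = scale (cyc x y z) u - scale (cyc x y u) z + scale (cyc x z u) y - scale (cyc y z u) x"
    using bracket_on_orthogonal_complement[of x y z u] by simp
  have tu: "br t u = scale (cyc x y t) u - scale (cyc x y u) t + scale (cyc x t u) y - scale (cyc y t u) x"
    using bracket_on_orthogonal_complement[of x y t u] by simp
  have xu: "br x u = scale (cyc z t x) u - scale (cyc z t u) x + scale (cyc z x u) t - scale (cyc t x u) z"
    using bracket_on_orthogonal_complement[of z t x u] by simp
  have yu: "br y u = scale (cyc z t y) u - scale (cyc z t u) y + scale (cyc z y u) t - scale (cyc t y u) z"
    using bracket_on_orthogonal_complement[of z t y u] by simp
  \<comment> \<open>\<open>[x, y] + [z, t]\<close> stays in the span of the four vectors, so it is orthogonal to \<open>u\<close>.\<close>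
  have "br x y + br z t = scale (cyc x y z) t - scale (cyc x y t) z + scale (cyc x z t) y
      - scale (cyc y z t) x"
    using bracket_on_orthogonal_complement[of x y z t] by simp
  then have "\<omega> (br x y + br z t) u = 0" by (simp add: omega_simps)
  then have e: "\<omega> (br z t) u = - \<omega> (br x y) u"
    by (simp add: omega_simps eq_neg_iff_add_eq_0 add.commute)
  have 1: "cyc x y u = \<omega> (br x y) u + 2 * cyc z t u"
    unfolding cyc_def[of x y u] using anticommutative[of u x] xu yu by (simp add: omega_simps)
  have 2: "cyc z t u = \<omega> (br z t) u + 2 * cyc x y u"
    unfolding cyc_def[of z t u] using anticommutative[of u z] zu tu by (simp add: omega_simps)
  have "cyc x y u + cyc z t u = 0" using 1 2 e by algebra
  then show 3: "cyc z t u = - cyc x y u" by (simp add: eq_neg_iff_add_eq_0 add.commute)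
  show "3 * cyc x y u = \<omega> (br x y) u" using 1 3 by algebra
  have ux: "\<omega> (br u x) z = - cyc x z u"
    using anticommutative[of u x] xu cyc_swap[of x z u] by (simp add: omega_simps)
  have "\<omega> (br z u) x = - cyc x z u" using zu by (simp add: omega_simps)
  from cyc_def[of x z u, unfolded ux this]
  show "3 * cyc x z u = \<omega> (br x z) u" by (simp add: algebra_simps)
qed

section \<open>Forms of rank at least six\<close>

definition symplectic_six :: "'b \<Rightarrow> 'b \<Rightarrow> 'b \<Rightarrow> 'b \<Rightarrow> 'b \<Rightarrow> 'b \<Rightarrow> bool" where
  "symplectic_six x y z t v w \<longleftrightarrow>
     symplectic_four x y z t \<and> symplectic_four x y v w \<and> symplectic_four z t v w"

lemma
  assumes "symplectic_six x y z t v w"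
  shows symplectic_six_swap: "symplectic_six z t x y v w"
    and symplectic_six_cycle: "symplectic_six z t v w x y"
    and symplectic_six_rotate: "symplectic_six x y t (- z) v w"
  using assms symplectic_four_swap symplectic_four_rotate_left symplectic_four_rotate_right
  unfolding symplectic_six_def by blast+

text \<open>
  For \<open>x\<close> and \<open>z\<close> in different pairs the third pair \<open>v, w\<close> expresses \<open>[x, z]\<close>. Its component along \<open>w\<close>
  is \<open>cyc v x z\<close>; pairing with \<open>v\<close> turns this into \<open>\<omega>([x, z], v) = - cyc x z v\<close>, whereas
  \<open>cyc_across_pairs\<close> makes the same value \<open>3 cyc x z v\<close>. So \<open>4 cyc x z v = 0\<close>.
\<close>
lemma bracket_across_pairs_aux:
  assumes six: "symplectic_six x y z t v w"
  shows "br x z = scale (cyc v w x) z - scale (cyc v w z) x + scale (cyc v x z) w - scale (cyc w x z) v"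
    and "cyc v x z = 0"
proof -
  have four: "symplectic_four x y z t" "symplectic_four x y v w" "symplectic_four z t v w"
    using six by (auto simp: symplectic_six_def)
  note \<omega> = omega_symplectic_four[OF four(1)] omega_symplectic_four[OF four(2)]
    omega_symplectic_four[OF four(3)]
  show br: "br x z = scale (cyc v w x) z - scale (cyc v w z) x + scale (cyc v x z) w - scale (cyc w x z) v"
    using bracket_on_orthogonal_complement[of v w x z] by (simp add: \<omega>)
  have "\<omega> (br x z) v = - cyc v x z"
    using br by (simp add: omega_simps \<omega> omega_self)
  moreover have "3 * cyc x z v = \<omega> (br x z) v"
    using six by (intro cyc_across_pairs[of x y z t]) (simp_all add: symplectic_six_def \<omega>)
  ultimately have "2 * (2 * cyc v x z) = 0"
    using cyc_rotate[of v x z] by algebra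
  then show "cyc v x z = 0" by (metis mult_eq_0_iff two_neq_zero)
qed

lemma bracket_across_pairs:
  assumes "symplectic_six x y z t v w"
  shows "br x z = scale (cyc v w x) z - scale (cyc v w z) x"
proof -
  have "symplectic_six x y z t w (- v)"
    using assms by (meson symplectic_six_cycle symplectic_six_rotate)
  then have "cyc w x z = 0" by (rule bracket_across_pairs_aux)
  then show ?thesis using bracket_across_pairs_aux[OF assms] by simp
qed

text \<open>
  The sums \<open>[x, y] + [z, t]\<close>, \<open>[x, y] + [v, w]\<close> and \<open>[z, t] + [v, w]\<close> are all known, so
  \<open>2 [x, y]\<close> is the sum of the first two minus the third.
\<close>
lemma
  assumes six: "symplectic_six x y z t v w"
  shows cyc_two_other_pairs: "cyc z t v = - cyc x y v" "cyc z t w = - cyc x y w"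
    and bracket_of_pair: "br x y = scale (cyc x y z) t - scale (cyc x y t) z
      + scale (cyc x y v) w - scale (cyc x y w) v"
proof -
  have four: "symplectic_four x y z t" "symplectic_four x y v w" "symplectic_four z t v w"
    using six by (auto simp: symplectic_six_def)
  note \<omega> = omega_symplectic_four[OF four(1)] omega_symplectic_four[OF four(2)]
    omega_symplectic_four[OF four(3)]
  show *: "cyc z t v = - cyc x y v" "cyc z t w = - cyc x y w"
    using four by (auto intro!: cyc_hyperbolic_pairs simp: \<omega>)
  have v: "cyc v w x = - cyc z t x" "cyc v w y = - cyc z t y"
    using four by (auto intro!: cyc_hyperbolic_pairs simp: \<omega>)
  have z: "cyc v w z = - cyc x y z" "cyc v w t = - cyc x y t"
    using four by (auto intro!: cyc_hyperbolic_pairs simp: \<omega>)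
  note rot = cyc_rotate[of x z t] cyc_rotate[of y z t] cyc_rotate[of x v w] cyc_rotate[of y v w]
    cyc_rotate[of z v w] cyc_rotate[of t v w]
  have e12: "br x y + br z t = scale (cyc x y z) t - scale (cyc x y t) z + (scale (cyc z t x) y
      - scale (cyc z t y) x)"
    using bracket_on_orthogonal_complement[of x y z t] by (simp add: \<omega> rot)
  have e13: "br x y + br v w = scale (cyc x y v) w - scale (cyc x y w) v - (scale (cyc z t x) y
      - scale (cyc z t y) x)"
    using bracket_on_orthogonal_complement[of x y v w] by (simp add: \<omega> rot v)
  have e23: "br z t + br v w = - (scale (cyc x y v) w - scale (cyc x y w) v) - (scale (cyc x y z) t
      - scale (cyc x y t) z)"
    using bracket_on_orthogonal_complement[of z t v w] by (simp add: \<omega> rot z *)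
  have "scale 2 (br x y) = (br x y + br z t) + (br x y + br v w) - (br z t + br v w)"
    by (simp add: scale_two)
  also have "\<dots> = scale 2 (scale (cyc x y z) t - scale (cyc x y t) z
      + (scale (cyc x y v) w - scale (cyc x y w) v))"
    unfolding e12 e13 e23 scale_two by (simp add: algebra_simps)
  finally show "br x y = scale (cyc x y z) t - scale (cyc x y t) z
      + scale (cyc x y v) w - scale (cyc x y w) v"
    using two_neq_zero by (simp only: scale_cancel_left) (simp add: algebra_simps)
qed

text \<open>
  The component along \<open>z\<close> of \<open>J(x, y, z) = z\<close>, read off by pairing with \<open>t\<close>; every bracket in
  \<open>J\<close> is known by the two preceding results.
\<close>
lemma symplectic_six_product:
  assumes six: "symplectic_six x y z t v w"
  shows "2 * (cyc v w z * cyc v w t) = 1"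
proof -
  have pairs: "symplectic_six z t x y v w" "symplectic_six v w z t x y" "symplectic_six x y v w z t"
    using six by (meson symplectic_six_swap symplectic_six_cycle)+
  have left: "symplectic_six y (- x) z t v w" "symplectic_six w (- v) z t x y"
    using six by (meson symplectic_six_swap symplectic_six_cycle symplectic_six_rotate)+
  have four: "symplectic_four x y z t" "symplectic_four x y v w" "symplectic_four z t v w"
    using six by (auto simp: symplectic_six_def)
  note \<omega> = omega_symplectic_four[OF four(1)] omega_symplectic_four(5-12)[OF four(2)]
    omega_symplectic_four(3-12)[OF four(3)]
  have zx: "br z x = scale (cyc v w z) x - scale (cyc v w x) z"
    using bracket_across_pairs[OF six] anticommutative[of z x] by simp
  have yz: "br y z = scale (cyc v w y) z - scale (cyc v w z) y"
    using bracket_across_pairs[OF left(1)] by simp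
  have vz: "br v z = scale (cyc x y v) z - scale (cyc x y z) v"
    using bracket_across_pairs[OF pairs(2)] by simp
  have wz: "br w z = scale (cyc x y w) z - scale (cyc x y z) w"
    using bracket_across_pairs[OF left(2)] by simp
  have tz: "br t z = - (scale (cyc z t x) y - scale (cyc z t y) x
      + scale (cyc z t v) w - scale (cyc z t w) v)"
    using bracket_of_pair[OF pairs(1)] anticommutative[of t z] by simp
  have yx: "\<omega> (br y x) t = cyc x y t"
    using bracket_of_pair[OF six] anticommutative[of y x] by (simp add: omega_simps \<omega> omega_self)
  have xy: "\<omega> (br x y) t = - cyc x y t"
    using bracket_of_pair[OF six] by (simp add: omega_simps \<omega> omega_self)
  have "\<omega> (br (br x y) z) t = 0"
    unfolding bracket_of_pair[OF six]
    by (simp add: br_simps br_self tz vz wz omega_simps \<omega> omega_self)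
  moreover have "\<omega> (br (br z x) y) t = - cyc v w z * cyc x y t - cyc v w x * \<omega> (br z y) t"
    by (simp add: zx br_simps omega_simps xy)
  moreover have "\<omega> (br z y) t = - cyc v w y"
    using anticommutative[of z y] by (simp add: yz omega_simps \<omega>)
  moreover have "\<omega> (br (br y z) x) t = cyc v w y * \<omega> (br z x) t - cyc v w z * cyc x y t"
    by (simp add: yz br_simps omega_simps yx)
  moreover have "\<omega> (br z x) t = - cyc v w x"
    by (simp add: zx omega_simps \<omega>)
  moreover have "\<omega> (jacobian x y z) t = 1"
    unfolding omega_jacobi by (simp add: omega_simps \<omega>)
  moreover have "cyc v w t = - cyc x y t"
    using cyc_two_other_pairs(2)[OF pairs(3)] .
  ultimately show ?thesis
    unfolding jacobian_def omega_add_left by algebra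
qed

text \<open>
  Replacing the pair \<open>z, t\<close> by the hyperbolic pair \<open>t, -z\<close> changes the sign of the product in
  \<open>symplectic_six_product\<close>, but not its value \<open>1\<close>.
\<close>
lemma no_symplectic_six: "\<not> symplectic_six x y z t v w"
proof
  assume six: "symplectic_six x y z t v w"
  have "1 = 2 * (cyc v w t * - cyc v w z)"
    using symplectic_six_product[OF symplectic_six_rotate[OF six]] by (simp only: cyc_minus)
  also have "\<dots> = - (2 * (cyc v w z * cyc v w t))" by (simp add: mult.commute)
  also have "\<dots> = - 1" by (simp only: symplectic_six_product[OF six])
  finally have "(2::'a) = 0" by (metis add.right_inverse one_add_one)
  then show False using two_neq_zero by simp
qed

section \<open>Forms of rank four\<close>

text \<open>
  For \<open>u\<close> in the kernel all values of \<open>cyc\<close> at \<open>u\<close> and two of the four vectors vanish, so each of the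
  four vectors has \<open>u\<close> as an eigenvector. Then \<open>J(x, y, u) = u\<close> reduces to \<open>[[x, y], u] = u\<close>, and
  likewise for \<open>z, t\<close>; thus \<open>[x, y] + [z, t]\<close> acts on \<open>u\<close> as 2. But in the expansion
  of this sum each vector is weighted, up to sign, by the eigenvalue of its partner, with opposite
  signs inside each pair, so it acts as 0.
\<close>
lemma symplectic_four_no_kernel:
  assumes four: "symplectic_four x y z t" and u: "\<And>v. \<omega> u v = 0"
  shows "u = 0"
proof -
  note \<omega> = omega_symplectic_four[OF four]
  have u': "\<omega> v u = 0" for v using u[of v] omega_skew[of u v] by simp
  note four' = four symplectic_four_swap[OF four]
    symplectic_four_rotate_left[OF four] symplectic_four_rotate_right[OF four]
    symplectic_four_rotate_right[OF symplectic_four_rotate_left[OF four]]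
  have "3 * cyc x y u = 0" "3 * cyc x z u = 0" "3 * cyc y z u = 0" "3 * cyc x t u = 0"
     "3 * cyc y t u = 0" "3 * cyc z t u = 0"
    using four'[THEN cyc_across_pairs, of u] four'[THEN cyc_hyperbolic_pair, of u]
    by (simp_all add: u')
  then have "cyc x y u = 0" "cyc x z u = 0" "cyc y z u = 0" "cyc x t u = 0"
     "cyc y t u = 0" "cyc z t u = 0" using three_neq_zero by simp_all
  moreover from this have "cyc z x u = 0" "cyc z y u = 0" "cyc t x u = 0" "cyc t y u = 0"
    using cyc_swap[of x z u] cyc_swap[of y z u] cyc_swap[of x t u] cyc_swap[of y t u] by simp_all
  ultimately have br: "br z u = scale (cyc x y z) u" "br t u = scale (cyc x y t) u"
    "br x u = scale (cyc z t x) u" "br y u = scale (cyc z t y) u"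
    using bracket_on_orthogonal_complement[of x y z u] bracket_on_orthogonal_complement[of x y t u]
      bracket_on_orthogonal_complement[of z t x u] bracket_on_orthogonal_complement[of z t y u]
    by (simp_all add: \<omega> u')
  have "br (br x y) u = u" using omega_jacobi[of x y u] br anticommutative[of u x]
      anticommutative[of u y] anticommutative[of u z] anticommutative[of u t]
    by (simp add: jacobian_def \<omega> u u' br_simps mult.commute)
  moreover have "br (br z t) u = u" using omega_jacobi[of z t u] br anticommutative[of u x]
      anticommutative[of u y] anticommutative[of u z] anticommutative[of u t]
    by (simp add: jacobian_def \<omega> u u' br_simps mult.commute)
  moreover have "br x y + br z t = scale (cyc x y z) t - scale (cyc x y t) z
      + scale (cyc z t x) y - scale (cyc z t y) x"
    using bracket_on_orthogonal_complement[of x y z t] cyc_rotate[of x z t] cyc_rotate[of y z t]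
    by (simp add: \<omega>)
  then have "br (br x y + br z t) u = 0"
    by (simp add: br_simps br mult.commute)
  ultimately have "scale 2 u = 0" by (simp add: br_simps scale_two)
  then show ?thesis using two_neq_zero by simp
qed

text \<open>
  When \<open>x, y, z, t\<close> is a symplectic basis, \<open>\<omega>(v, y)\<close> and \<open>- \<omega>(v, x)\<close> are the coordinates of \<open>v\<close> along
  \<open>x\<close> and \<open>y\<close>, so this is the trace of \<open>T\<close>.
\<close>
definition symplectic_trace :: "'b \<Rightarrow> 'b \<Rightarrow> 'b \<Rightarrow> 'b \<Rightarrow> ('b \<Rightarrow> 'b) \<Rightarrow> 'a" where
  "symplectic_trace x y z t T = \<omega> (T x) y - \<omega> (T y) x + \<omega> (T z) t - \<omega> (T t) z"

text \<open>
  If only 0 is orthogonal to all four vectors, then they span \<open>L\<close>. Let \<open>l(v)\<close> be the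
  trace of \<open>[v, \<cdot>]\<close>. As traces of commutators vanish, the trace of \<open>J(a, b, \<cdot>)\<close> is \<open>l([a, b])\<close>; the form side has
  trace \<open>(dim L - 2) \<omega>(a, b)\<close>. So \<open>l([a, b]) = 2 \<omega>(a, b)\<close>, and applying \<open>l\<close> to a Jacobian
  determines \<open>cyc\<close> through \<open>l\<close>. It follows that \<open>l\<close> vanishes on \<open>[x, y] + [z, t]\<close>,
  although its value there is \<open>2 + 2\<close>.
\<close>
lemma symplectic_four_degenerate:
  assumes four: "symplectic_four x y z t"
  obtains u where "u \<noteq> 0" "\<omega> x u = 0" "\<omega> y u = 0" "\<omega> z u = 0" "\<omega> t u = 0"
proof (rule ccontr)
  assume *: "\<not> thesis"
  note \<omega> = omega_symplectic_four[OF four]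
  note [simp] = omega_simps br_simps \<omega> omega_self
  \<comment> \<open>Every vector is its projection to the four vectors, the difference being orthogonal to them.\<close>
  have coords: "v = scale (\<omega> v y) x - scale (\<omega> v x) y + scale (\<omega> v t) z - scale (\<omega> v z) t" for v
  proof -
    let ?u = "v - (scale (\<omega> v y) x - scale (\<omega> v x) y + scale (\<omega> v t) z - scale (\<omega> v z) t)"
    have "\<omega> x ?u = 0" "\<omega> y ?u = 0" "\<omega> z ?u = 0" "\<omega> t ?u = 0"
      using omega_skew[of x v] omega_skew[of y v] omega_skew[of z v] omega_skew[of t v] by simp_all
    then have "?u = 0" using * that by blast
    then show ?thesis by simp
  qed
  define l where "l v = symplectic_trace x y z t (br v)" for v
  have l_linear: "l (u + v) = l u + l v" "l (u - v) = l u - l v" "l (scale c u) = c * l u" for u v c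
    by (simp_all add: l_def symplectic_trace_def algebra_simps)
  have commute: "symplectic_trace x y z t (\<lambda>e. br a (br b e)) = symplectic_trace x y z t (\<lambda>e. br b (br a e))" for a b
  proof -
    have expand: "br c (br d e) = scale (\<omega> (br d e) y) (br c x) - scale (\<omega> (br d e) x) (br c y)
      + scale (\<omega> (br d e) t) (br c z) - scale (\<omega> (br d e) z) (br c t)" for c d e
      using arg_cong[OF coords[of "br d e"], of "br c"] by (simp only: br_simps)
    show ?thesis
      unfolding symplectic_trace_def expand[of a b] expand[of b a] by (simp add: algebra_simps)
  qed
  have "jacobian a b c = br (br a b) c + br b (br a c) - br a (br b c)" for a b c
    unfolding jacobian_def using anticommutative[of c a] anticommutative[of "br a c" b]
      anticommutative[of "br b c" a] by simp
  then have "symplectic_trace x y z t (jacobian a b) = l (br a b)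
      + symplectic_trace x y z t (\<lambda>e. br b (br a e)) - symplectic_trace x y z t (\<lambda>e. br a (br b e))" for a b
    by (simp add: l_def symplectic_trace_def)
  then have trace: "l (br a b) = symplectic_trace x y z t (jacobian a b)" for a b
    using commute by simp
  have l_br: "l (br a b) = 2 * \<omega> a b" for a b
  proof -
    have "\<omega> b a = \<omega> b y * \<omega> x a - \<omega> b x * \<omega> y a + \<omega> b t * \<omega> z a - \<omega> b z * \<omega> t a"
      using arg_cong[OF coords[of b], of "\<lambda>v. \<omega> v a"] by (simp only: omega_simps)
    moreover have "\<omega> x a = - \<omega> a x" "\<omega> y a = - \<omega> a y" "\<omega> z a = - \<omega> a z" "\<omega> t a = - \<omega> a t"
       "\<omega> b a = - \<omega> a b" by (rule omega_skew)+
    ultimately show ?thesis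
      unfolding trace omega_jacobi symplectic_trace_def by simp
  qed
  have l_cyc: "2 * cyc a b c = \<omega> a b * l c + \<omega> c a * l b + \<omega> b c * l a" for a b c
  proof -
    have "l (jacobian a b c) = 2 * cyc a b c"
      by (simp add: jacobian_def l_linear l_br cyc_def algebra_simps)
    then show ?thesis by (simp add: omega_jacobi l_linear)
  qed
  have "br x y + br z t = scale (cyc x y z) t - scale (cyc x y t) z + scale (cyc x z t) y
      - scale (cyc y z t) x"
    using bracket_on_orthogonal_complement[of x y z t] by simp
  then have "l (br x y + br z t) = cyc x y z * l t - cyc x y t * l z + cyc x z t * l y - cyc y z t * l x"
    by (simp only: l_linear)
  also have "\<dots> = 0"
  proof -
    have "l z = 2 * cyc x y z" "l t = 2 * cyc x y t" "l x = 2 * cyc x z t" "l y = 2 * cyc y z t"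
      by (simp_all add: l_cyc)
    then show ?thesis by simp
  qed
  finally have "l (br x y + br z t) = 0" .
  moreover have "l (br x y + br z t) = 2 * 2" by (simp add: l_linear l_br)
  ultimately show False using two_neq_zero by (metis mult_eq_0_iff)
qed

lemma hyperbolic_split:
  assumes "\<omega> x y = 1"
  shows "\<omega> x (v - scale (\<omega> v y) x + scale (\<omega> v x) y) = 0"
    and "\<omega> y (v - scale (\<omega> v y) x + scale (\<omega> v x) y) = 0"
  using assms omega_skew[of x v] omega_skew[of y v] omega_skew[of y x]
  by (simp_all add: omega_simps omega_self)

text \<open>
  If \<open>z\<close> were not in the kernel, it would belong to a second hyperbolic pair \<open>z, t'\<close>. By
  \<open>symplectic_four_degenerate\<close> and \<open>symplectic_four_no_kernel\<close> some \<open>u \<noteq> 0\<close> is orthogonal to both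
  pairs and not in the kernel, so it in turn belongs to a third pair. Partners are made
  orthogonal by projection and then normalised.
\<close>
lemma orthogonal_complement_in_kernel:
  assumes xy: "\<omega> x y = 1" and z: "\<omega> x z = 0" "\<omega> y z = 0"
  shows "z \<in> form_kernel \<omega>"
proof (rule ccontr)
  assume "z \<notin> form_kernel \<omega>"
  then obtain t where t: "\<omega> z t \<noteq> 0" by (auto simp: form_kernel_def)
  have z': "\<omega> z x = 0" "\<omega> z y = 0" using z omega_skew[of z x] omega_skew[of z y] by simp_all
  define t' where "t' = scale (inverse (\<omega> z t)) (t - scale (\<omega> t y) x + scale (\<omega> t x) y)"
  have four: "symplectic_four x y z t'"
    unfolding symplectic_four_def t'_def
    using xy z z' t hyperbolic_split[OF xy, of t]
    by (simp add: omega_scale_right) (simp add: omega_simps)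
  obtain u where u: "u \<noteq> 0" "\<omega> x u = 0" "\<omega> y u = 0" "\<omega> z u = 0" "\<omega> t' u = 0"
    using symplectic_four_degenerate[OF four] .
  obtain v where v: "\<omega> u v \<noteq> 0" using symplectic_four_no_kernel[OF four] u(1) by blast
  have u': "\<omega> u x = 0" "\<omega> u y = 0" "\<omega> u z = 0" "\<omega> u t' = 0"
    using u omega_skew[of u x] omega_skew[of u y] omega_skew[of u z] omega_skew[of u t'] by simp_all
  define p where "p = v - scale (\<omega> v y) x + scale (\<omega> v x) y"
  define w where "w = scale (inverse (\<omega> u v)) (p - scale (\<omega> p t') z + scale (\<omega> p z) t')"
  have zt: "\<omega> z t' = 1" and perp: "\<omega> x z = 0" "\<omega> x t' = 0" "\<omega> y z = 0" "\<omega> y t' = 0"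
    using four by (simp_all add: symplectic_four_def)
  have p: "\<omega> x p = 0" "\<omega> y p = 0" "\<omega> u p = \<omega> u v"
    using hyperbolic_split[OF xy, of v] by (simp_all add: p_def omega_simps u')
  have w: "\<omega> x w = 0" "\<omega> y w = 0" "\<omega> u w = 1" "\<omega> z w = 0" "\<omega> t' w = 0"
    using hyperbolic_split[OF zt, of p] v perp p
    by (simp_all add: w_def omega_scale_right) (simp_all add: omega_simps u')
  have "symplectic_six x y z t' u w"
    using four u w xy zt by (simp add: symplectic_six_def symplectic_four_def)
  then show False by (simp add: no_symplectic_six)
qed

section \<open>The kernel of the form\<close>

lemma form_kernelD: "z \<in> form_kernel \<omega> \<Longrightarrow> \<omega> z v = 0" "z \<in> form_kernel \<omega> \<Longrightarrow> \<omega> v z = 0"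
  using omega_skew[of z v] by (simp_all add: form_kernel_def)

lemma subspace_form_kernel: "subspace (form_kernel \<omega>)"
  by (auto simp: subspace_def form_kernel_def omega_simps)

text \<open>
  The components of \<open>[z, t]\<close> along \<open>x\<close> and \<open>y\<close> equal, up to sign, \<open>\<omega>([z, t], y)\<close> and
  \<open>\<omega>([z, t], x)\<close>. Computing the latter from the expansion of \<open>[z, t]\<close> returns the same values with
  the opposite sign, so they vanish.
\<close>
lemma br_eq_kernel_combination:
  assumes "\<omega> x y = 1" and z: "z \<in> form_kernel \<omega>" and t: "t \<in> form_kernel \<omega>"
  shows "br z t = scale (cyc x y z) t - scale (cyc x y t) z"
proof -
  note [simp] = form_kernelD[OF z] form_kernelD[OF t] omega_simps omega_self assms(1)
  have yx: "\<omega> y x = - 1" using omega_skew[of y x] by simp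
  have br: "br z t = scale (cyc x y z) t - scale (cyc x y t) z + scale (cyc x z t) y
      - scale (cyc y z t) x"
    using bracket_on_orthogonal_complement[of x y z t] by simp
  have "\<omega> (br z t) x = - cyc x z t" "\<omega> (br z t) y = - cyc y z t"
    unfolding br by (simp_all add: yx)
  moreover have "cyc x z t = \<omega> (br z t) x" "cyc y z t = \<omega> (br z t) y" by (simp_all add: cyc_def)
  ultimately have "2 * cyc x z t = 0" "2 * cyc y z t = 0" by algebra+
  then have "cyc x z t = 0" "cyc y z t = 0" using two_neq_zero by simp_all
  then show ?thesis using br by simp
qed

lemma jacobian_isotropic:
  assumes "\<omega> u v = 0" "\<omega> w u = 0" "\<omega> v w = 0"
  shows "jacobian u v w = 0"
  using assms by (simp add: omega_jacobi)

text \<open>\<open>L\<close> is a module over the Lie algebra \<open>Ker \<omega>\<close>.\<close>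
lemma br_commutator_kernel:
  assumes "z \<in> form_kernel \<omega>" "t \<in> form_kernel \<omega>"
  shows "br z (br t v) = br t (br z v) + br (br z t) v"
proof -
  have "jacobian z t v = 0"
    using assms by (simp add: jacobian_isotropic form_kernelD)
  then have "br (br z t) v + br (br v z) t + br (br t v) z = 0" by (simp add: jacobian_def)
  moreover have "br (br v z) t = br t (br z v)"
    using anticommutative[of "br v z" t] anticommutative[of v z] by (simp add: br_simps)
  moreover have "br (br t v) z = - br z (br t v)" by (rule anticommutative)
  ultimately show ?thesis by (simp add: algebra_simps)
qed

end

text \<open>
  By \<open>orthogonal_complement_in_kernel\<close>, a hyperbolic pair is a basis of \<open>L\<close> modulo \<open>Ker \<omega>\<close>. The
  coordinates of \<open>v\<close> modulo \<open>Ker \<omega>\<close> are \<open>\<omega> v y\<close> for \<open>x\<close> and \<open>- \<omega> v x\<close> for \<open>y\<close>.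
\<close>
locale hyperbolic_pair = omega_lie_algebra_char_not_2_3 +
  fixes x y
  assumes hyperbolic: "\<omega> x y = 1"
begin

lemma omega_y_x: "\<omega> y x = - 1"
  using hyperbolic omega_skew[of y x] by simp

abbreviation Z :: "'b set" where "Z \<equiv> form_kernel \<omega>"

text \<open>
  On \<open>Z\<close> this linear form determines the bracket (\<open>br_Z\<close>) and is the trace of \<open>[z, \<cdot>]\<close> on \<open>L/Z\<close>
  (\<open>trace_eq_f\<close>).
\<close>
definition f :: "'b \<Rightarrow> 'a" where "f z = cyc x y z"

lemma f_linear: "f (u + v) = f u + f v" "f (u - v) = f u - f v" "f (scale c u) = c * f u" "f (- u) = - f u"
  by (simp_all add: f_def cyc_def br_simps omega_simps algebra_simps)

lemma br_Z: "z \<in> Z \<Longrightarrow> t \<in> Z \<Longrightarrow> br z t = scale (f z) t - scale (f t) z"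
  unfolding f_def by (rule br_eq_kernel_combination[OF hyperbolic])

lemma Z_closed: "0 \<in> Z" "u \<in> Z \<Longrightarrow> v \<in> Z \<Longrightarrow> u + v \<in> Z" "u \<in> Z \<Longrightarrow> v \<in> Z \<Longrightarrow> u - v \<in> Z"
  "u \<in> Z \<Longrightarrow> scale c u \<in> Z" "u \<in> Z \<Longrightarrow> - u \<in> Z"
  by (simp_all add: form_kernel_def omega_simps)

lemma br_Z_in_Z: "z \<in> Z \<Longrightarrow> t \<in> Z \<Longrightarrow> br z t \<in> Z"
  by (simp add: br_Z Z_closed)

lemma Z_iff: "v \<in> Z \<longleftrightarrow> \<omega> v x = 0 \<and> \<omega> v y = 0"
  using orthogonal_complement_in_kernel[OF hyperbolic, of v] omega_skew[of v x] omega_skew[of v y]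
  by (auto simp: form_kernel_def)

lemma Z_component: "v - scale (\<omega> v y) x + scale (\<omega> v x) y \<in> Z"
  using orthogonal_complement_in_kernel[OF hyperbolic] hyperbolic_split[OF hyperbolic] by blast

lemma x_notin_Z: "x \<notin> Z"
  by (simp add: Z_iff hyperbolic)

lemma lie_subalgebra_Z: "lie_subalgebra Z"
  unfolding lie_subalgebra_def subalgebra_def
  by (auto simp: subspace_form_kernel br_Z_in_Z intro!: jacobian_isotropic dest: form_kernelD)

text \<open>The action of \<open>z\<close> on \<open>L/Z\<close>, in coordinates with respect to \<open>x, y\<close>.\<close>
lemma
  assumes "z \<in> Z"
  shows omega_br_y: "\<omega> (br z v) y = \<omega> v y * \<omega> (br z x) y - \<omega> v x * \<omega> (br z y) y"
    and omega_br_x: "\<omega> (br z v) x = \<omega> v y * \<omega> (br z x) x - \<omega> v x * \<omega> (br z y) x"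
proof -
  have "br z (v - scale (\<omega> v y) x + scale (\<omega> v x) y) \<in> Z"
    using assms Z_component by (rule br_Z_in_Z)
  then show "\<omega> (br z v) y = \<omega> v y * \<omega> (br z x) y - \<omega> v x * \<omega> (br z y) y"
    and "\<omega> (br z v) x = \<omega> v y * \<omega> (br z x) x - \<omega> v x * \<omega> (br z y) x"
    unfolding Z_iff by (simp_all add: br_simps omega_simps algebra_simps)
qed

lemma trace_eq_f: "z \<in> Z \<Longrightarrow> \<omega> (br z x) y - \<omega> (br z y) x = f z"
  unfolding f_def cyc_def using anticommutative[of y z] by (simp add: form_kernelD omega_simps)

section \<open>Nilpotency of the abelian part\<close>

text \<open>
  By the Cayley-Hamilton theorem, a traceless \<open>2 \<times> 2\<close> matrix squares to the scalar \<open>\<delta>\<close>, minus its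
  determinant.
\<close>
lemma br_br_Z:
  assumes z: "z \<in> Z" and f: "f z = 0"
  defines "\<delta> \<equiv> \<omega> (br z x) y * \<omega> (br z x) y - \<omega> (br z x) x * \<omega> (br z y) y"
  shows "\<omega> (br z (br z v)) y = \<delta> * \<omega> v y" "\<omega> (br z (br z v)) x = \<delta> * \<omega> v x"
proof -
  have "\<omega> (br z y) x = \<omega> (br z x) y" using trace_eq_f[OF z] f by simp
  then show "\<omega> (br z (br z v)) y = \<delta> * \<omega> v y" "\<omega> (br z (br z v)) x = \<delta> * \<omega> v x"
    unfolding omega_br_y[OF z, of "br z v"] omega_br_x[OF z, of "br z v"]
      omega_br_y[OF z, of v] omega_br_x[OF z, of v] \<delta>_def by (simp_all add: algebra_simps)
qed

text \<open>
  On \<open>L/Z\<close> write \<open>\<rho>\<close> for the action, so that \<open>\<rho>(h)\<^sup>2 = \<delta>\<close>. Since \<open>[z, h] = f(z) h\<close>, the commutator of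
  \<open>\<rho>(z)\<close> with \<open>\<rho>(h)\<^sup>2\<close> is \<open>2 f(z) \<rho>(h)\<^sup>2\<close>; but a scalar commutes with \<open>\<rho>(z)\<close>, so \<open>\<delta> = 0\<close>. Hence
  \<open>[h, [h, \<cdot>]]\<close> maps \<open>L\<close> to \<open>Z\<close>, and it maps \<open>Z\<close> to 0 because \<open>[h, Z] \<subseteq> Kh\<close>.
\<close>
lemma ad_nilpotent:
  assumes z: "z \<in> Z" "f z \<noteq> 0" and h: "h \<in> Z" "f h = 0"
  shows "nilpotent_map (ad h)"
proof -
  define \<delta> where "\<delta> = \<omega> (br h x) y * \<omega> (br h x) y - \<omega> (br h x) x * \<omega> (br h y) y"
  note hh = br_br_Z[OF h, folded \<delta>_def]
  have comm: "br z (br h v) = br h (br z v) + scale (f z) (br h v)" for v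
    using br_commutator_kernel[OF z(1) h(1), of v] br_Z[OF z(1) h(1)] h(2) by (simp add: br_simps)
  have "br z (br h (br h x)) = br h (br h (br z x)) + scale (2 * f z) (br h (br h x))"
    by (simp add: comm br_simps scale_two scale_right_distrib mult.commute[of 2] flip: scale_scale)
  then have "\<omega> (br z (br h (br h x))) y = \<omega> (br h (br h (br z x))) y + (2 * f z) * \<omega> (br h (br h x)) y"
    by (simp add: omega_simps)
  moreover have "\<omega> (br z (br h (br h x))) y = \<delta> * \<omega> (br z x) y"
    unfolding omega_br_y[OF z(1), of "br h (br h x)"] by (simp add: hh hyperbolic omega_self)
  ultimately have "2 * (f z * \<delta>) = 0" by (simp add: hh hyperbolic)
  then have \<delta>: "\<delta> = 0" using z(2) two_neq_zero by (metis mult_eq_0_iff)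
  have hhZ: "br h (br h v) \<in> Z" for v
    by (simp add: Z_iff hh \<delta>)
  have hh0: "br h (br h u) = 0" if "u \<in> Z" for u
    using br_Z[OF h(1) that] h(2) by (simp add: br_simps br_self)
  have "ad h (ad h v) = br h (br h v)" for v
    unfolding ad_def using anticommutative[of v h] anticommutative[of "br v h" h] by (simp add: br_simps)
  then have "(ad h ^^ 4) v = 0" for v
    using hh0[OF hhZ] by (simp add: eval_nat_numeral)
  then show ?thesis unfolding nilpotent_map_def by blast
qed

section \<open>The abelian kernel\<close>

lemma br_Z_abelian:
  assumes ab: "\<forall>z\<in>Z. f z = 0" and z: "z \<in> Z"
  shows "br z v = scale (\<omega> v y) (br z x) - scale (\<omega> v x) (br z y)"
proof -
  have "br z (v - scale (\<omega> v y) x + scale (\<omega> v x) y) = 0"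
    using br_Z[OF z Z_component] ab z Z_component by simp
  then show ?thesis by (simp add: br_simps algebra_simps)
qed

text \<open>
  Commuting traceless \<open>2 \<times> 2\<close> matrices are proportional in characteristic different from 2. The two
  cases are whether some \<open>z\<close> in \<open>Z\<close> acts on \<open>L/Z\<close> by an invertible matrix.
\<close>
lemma abelian_kernel_dichotomy:
  assumes ab: "\<forall>z\<in>Z. f z = 0"
  shows "(\<exists>v. v \<notin> Z \<and> (\<forall>z\<in>Z. br z v \<in> Z)) \<or> (\<exists>z. z \<noteq> 0 \<and> Z = span {z})"
proof -
  \<comment> \<open>Modulo \<open>Z\<close>: \<open>[z, x] = a x + b y\<close> and \<open>[z, y] = c x - a y\<close>.\<close>
  define a b c where "a z = \<omega> (br z x) y" and "b z = - \<omega> (br z x) x" and "c z = \<omega> (br z y) y" for z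
  have yx: "\<omega> (br z y) x = a z" if "z \<in> Z" for z
    using trace_eq_f[OF that] ab that by (simp add: a_def)
  have matrix: "\<omega> (br z v) y = \<omega> v y * a z - \<omega> v x * c z"
    "\<omega> (br z v) x = - \<omega> v y * b z - \<omega> v x * a z" if "z \<in> Z" for z v
    using omega_br_y[OF that, of v] omega_br_x[OF that, of v] by (simp_all add: a_def b_def c_def yx that)
  have comm: "br z (br t v) = br t (br z v)" if "z \<in> Z" "t \<in> Z" for z t v
    using br_commutator_kernel[OF that, of v] br_Z[OF that] ab that by (simp add: br_simps)
  \<comment> \<open>\<open>z\<close> and \<open>t\<close> commute on \<open>x\<close> and on \<open>y\<close>; these equations hold in \<open>L\<close>, not only modulo \<open>Z\<close>.\<close>
  have I: "scale (a t) (br z x) + scale (b t) (br z y) = scale (a z) (br t x) + scale (b z) (br t y)"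
    and II: "scale (c t) (br z x) - scale (a t) (br z y) = scale (c z) (br t x) - scale (a z) (br t y)"
    if z: "z \<in> Z" and t: "t \<in> Z" for z t
    using comm[OF z t, of x] comm[OF z t, of y]
      br_Z_abelian[OF ab z, of "br t x"] br_Z_abelian[OF ab t, of "br z x"]
      br_Z_abelian[OF ab z, of "br t y"] br_Z_abelian[OF ab t, of "br z y"]
    by (simp_all add: a_def[symmetric] b_def c_def[symmetric] yx z t)
  have proportional: "\<exists>k. a t = k * a z \<and> b t = k * b z \<and> c t = k * c z"
    if z: "z \<in> Z" and t: "t \<in> Z" and nz: "a z \<noteq> 0 \<or> b z \<noteq> 0 \<or> c z \<noteq> 0" for z t
  proof -
    have "b t * c z = b z * c t"
      using arg_cong[OF I[OF z t], of "\<lambda>v. \<omega> v y"]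
      by (simp add: omega_simps matrix z t hyperbolic omega_y_x omega_self)
    moreover have "2 * (a t * b z - b t * a z) = 0"
      using arg_cong[OF I[OF z t], of "\<lambda>v. \<omega> v x"]
      by (simp add: omega_simps matrix z t hyperbolic omega_y_x omega_self) algebra
    then have "a t * b z = b t * a z" using two_neq_zero by simp
    moreover have "2 * (a t * c z - c t * a z) = 0"
      using arg_cong[OF II[OF z t], of "\<lambda>v. \<omega> v y"]
      by (simp add: omega_simps matrix z t hyperbolic omega_y_x omega_self) algebra
    then have "a t * c z = c t * a z" using two_neq_zero by simp
    ultimately show ?thesis
      using nz
      by (elim disjE; intro exI[of _ "if a z \<noteq> 0 then a t / a z
            else if b z \<noteq> 0 then b t / b z else c t / c z"])
        (auto simp: field_simps)
  qed
  show ?thesis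
  proof (cases "\<exists>z\<in>Z. a z * a z + b z * c z \<noteq> 0")
    case True
    then obtain z where z: "z \<in> Z" "a z * a z + b z * c z \<noteq> 0" by blast
    have "t \<in> span {z}" if t: "t \<in> Z" for t
    proof -
      obtain k where k: "a t = k * a z" "b t = k * b z" "c t = k * c z"
        using proportional[OF z(1) t] z(2) by fastforce
      \<comment> \<open>\<open>t'\<close> acts by zero on \<open>L/Z\<close>; it will be shown to annihilate \<open>L\<close> and hence to vanish.\<close>
      define t' where "t' = t - scale k z"
      have t': "t' \<in> Z" unfolding t'_def by (intro Z_closed t z)
      have "a t' = 0" "b t' = 0" "c t' = 0"
        using k by (simp_all add: t'_def a_def b_def c_def br_simps omega_simps algebra_simps)
      then have eqs: "scale (a z) (br t' x) + scale (b z) (br t' y) = 0"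
        "scale (c z) (br t' x) - scale (a z) (br t' y) = 0"
        using I[OF z(1) t'] II[OF z(1) t'] by simp_all
      \<comment> \<open>Cramer's rule for the two equations, whose determinant is nonzero.\<close>
      have "scale (a z * a z + b z * c z) (br t' x)
          = scale (a z) (scale (a z) (br t' x) + scale (b z) (br t' y))
            + scale (b z) (scale (c z) (br t' x) - scale (a z) (br t' y))"
        by (simp add: algebra_simps)
      then have x: "br t' x = 0" using eqs z(2) by simp
      have "scale (a z * a z + b z * c z) (br t' y)
          = scale (c z) (scale (a z) (br t' x) + scale (b z) (br t' y))
            - scale (a z) (scale (c z) (br t' x) - scale (a z) (br t' y))"
        by (simp add: algebra_simps)
      then have y: "br t' y = 0" using eqs z(2) by simp
      have "br t' v = 0" for v
        using br_Z_abelian[OF ab t', of v] x y by simp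
      moreover from this have "br v t' = 0" for v using anticommutative[of v t'] by simp
      ultimately have "jacobian x y t' = 0" by (simp add: jacobian_def br_simps)
      then have "t' = 0" by (simp add: omega_jacobi hyperbolic form_kernelD[OF t'])
      then show ?thesis unfolding t'_def by (auto simp: span_singleton)
    qed
    moreover have "span {z} \<subseteq> Z"
      using z subspace_form_kernel by (intro span_minimal) auto
    moreover have "z \<noteq> 0"
      using z by (auto simp: a_def b_def br_simps omega_simps)
    ultimately show ?thesis by blast
  next
    case False
    then have det: "a z * a z + b z * c z = 0" if "z \<in> Z" for z using that by blast
    show ?thesis
    proof (cases "\<exists>z\<in>Z. a z \<noteq> 0 \<or> b z \<noteq> 0")
      case True
      then obtain z where z: "z \<in> Z" "a z \<noteq> 0 \<or> b z \<noteq> 0" by blast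
      \<comment> \<open>The image of \<open>x\<close> under \<open>z\<close> modulo \<open>Z\<close>, killed by \<open>z\<close> as the square of its matrix is zero.\<close>
      define v where "v = scale (a z) x + scale (b z) y"
      have v: "\<omega> v y = a z" "\<omega> v x = - b z"
        by (simp_all add: v_def omega_simps omega_self hyperbolic omega_y_x)
      have "v \<notin> Z" using v z(2) by (auto simp: Z_iff)
      moreover have "br t v \<in> Z" if t: "t \<in> Z" for t
      proof -
        obtain k where k: "a t = k * a z" "b t = k * b z" "c t = k * c z"
          using proportional[OF z(1) t] z(2) by blast
        have "\<omega> (br t v) y = k * (a z * a z + b z * c z)"
          unfolding matrix[OF t] v k by (simp add: algebra_simps)
        moreover have "\<omega> (br t v) x = 0"
          unfolding matrix[OF t] v k by (simp add: algebra_simps)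
        ultimately show ?thesis using det[OF z(1)] by (simp add: Z_iff)
      qed
      ultimately show ?thesis by blast
    next
      case False
      then have "br z x \<in> Z" if "z \<in> Z" for z
        using that by (simp add: Z_iff a_def b_def)
      then show ?thesis using x_notin_Z by blast
    qed
  qed
qed

text \<open>
  The form vanishes on \<open>Z \<oplus> Kv\<close> because \<open>Z\<close> is its kernel and \<open>\<omega>(v, v) = 0\<close>, so the Jacobi identity
  holds there.
\<close>
lemma structure_a_insert:
  assumes ab: "\<forall>z\<in>Z. f z = 0" and v: "v \<notin> Z" "\<forall>z\<in>Z. br z v \<in> Z"
  shows "lie_subalgebra (span (insert v Z))" and "structure_a (span (insert v Z))"
proof -
  let ?M = "span (insert v Z)"
  have M: "\<exists>z k. z \<in> Z \<and> u = z + scale k v" if u: "u \<in> ?M" for u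
  proof -
    obtain k where "u - scale k v \<in> span Z" using u unfolding span_breakdown_eq by blast
    then have "u - scale k v \<in> Z" using subspace_form_kernel by (simp add: span_eq_iff[THEN iffD2])
    then show ?thesis by (intro exI[of _ "u - scale k v"] exI[of _ k]) simp
  qed
  have br0: "br z t = 0" if "z \<in> Z" "t \<in> Z" for z t using br_Z[OF that] ab that by simp
  have "br u w \<in> ?M" if uw: "u \<in> ?M" "w \<in> ?M" for u w
  proof -
    obtain z k z' k' where "z \<in> Z" "u = z + scale k v" "z' \<in> Z" "w = z' + scale k' v"
      using M uw by metis
    then have "br u w = scale k' (br z v) - scale k (br z' v)"
      using anticommutative[of v z'] by (simp add: br_simps br0 br_self algebra_simps)
    then have "br u w \<in> Z" using v(2) \<open>z \<in> Z\<close> \<open>z' \<in> Z\<close> by (simp add: Z_closed)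
    then show ?thesis by (intro span_base) simp
  qed
  moreover have "\<omega> u w = 0" if uw: "u \<in> ?M" "w \<in> ?M" for u w
  proof -
    obtain z k z' k' where "z \<in> Z" "u = z + scale k v" "z' \<in> Z" "w = z' + scale k' v"
      using M uw by metis
    then show ?thesis by (simp add: omega_simps form_kernelD omega_self)
  qed
  ultimately show "lie_subalgebra ?M"
    unfolding lie_subalgebra_def subalgebra_def by (auto intro: jacobian_isotropic)
  have "abelian_subalgebra Z"
    using lie_subalgebra_Z br0 by (simp add: abelian_subalgebra_def lie_subalgebra_def)
  moreover have "decomposes ?M Z [v]"
    using subspace_form_kernel v(1) by (rule decomposes_insert)
  ultimately show "structure_a ?M"
    unfolding structure_a_def ad_def using v(2) by blast
qed

section \<open>The almost abelian kernel and the structure theorem\<close>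

lemma almost_abelian_kernel:
  assumes z: "z \<in> Z" "f z \<noteq> 0"
  defines "H \<equiv> {h \<in> Z. f h = 0}"
  shows "almost_abelian Z H" "abelian_subalgebra H" "\<exists>w. w \<notin> H \<and> Z = span (insert w H)"
proof -
  \<comment> \<open>Normalised by \<open>f w = -1\<close>, so that \<open>[h, w] = - f(w) h = h\<close>.\<close>
  define w where "w = scale (- inverse (f z)) z"
  have w: "w \<in> Z" "f w = - 1"
    using z f_linear(3)[of "- inverse (f z)" z] by (simp_all add: w_def Z_closed)
  have H: "subspace H"
    using Z_closed f_linear(3)[of 0 0] by (auto simp: H_def subspace_def f_linear)
  show abelian: "abelian_subalgebra H"
    using H subspace_0[OF H] by (auto simp: abelian_subalgebra_def subalgebra_def br_Z) (auto simp: H_def br_Z)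
  have "ideal_of H Z"
    using H by (auto simp: ideal_of_def H_def br_Z Z_closed f_linear)
  moreover have "w \<notin> H" using w by (simp add: H_def)
  moreover have Z: "Z = span (insert w H)"
  proof
    show "span (insert w H) \<subseteq> Z"
      using subspace_form_kernel w by (intro span_minimal) (auto simp: H_def)
    show "Z \<subseteq> span (insert w H)"
    proof
      fix u assume u: "u \<in> Z"
      have "u - scale (- f u) w \<in> H"
        using u w by (simp add: H_def Z_closed f_linear)
      then have "u - scale (- f u) w \<in> span H" by (rule span_base)
      then show "u \<in> span (insert w H)" unfolding span_breakdown_eq by blast
    qed
  qed
  ultimately show "\<exists>w. w \<notin> H \<and> Z = span (insert w H)" by blast
  have "decomposes Z H [w]"
    using decomposes_insert[OF H \<open>w \<notin> H\<close>] Z by simp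
  moreover have "ad w h = h" if "h \<in> H" for h
    using that w by (simp add: ad_def H_def br_Z)
  ultimately show "almost_abelian Z H"
    unfolding almost_abelian_def using lie_subalgebra_Z abelian \<open>ideal_of H Z\<close> by blast
qed

lemma dim_UNIV_kernel:
  assumes "\<exists>B. finite B \<and> span B = UNIV"
  shows "dim (UNIV :: 'b set) = dim Z + 2"
proof -
  have Z: "span Z = Z" using subspace_form_kernel by (simp add: span_eq_iff)
  have y: "y \<notin> span Z" using omega_y_x by (auto simp: Z Z_iff)
  have x: "x \<notin> span (insert y Z)"
  proof
    assume "x \<in> span (insert y Z)"
    then obtain k where "x - scale k y \<in> Z" by (auto simp: span_breakdown_eq Z)
    then show False by (simp add: Z_iff omega_simps omega_self hyperbolic)
  qed
  have "v \<in> span (insert x (insert y Z))" for v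
  proof -
    have "v - scale (\<omega> v y) x - scale (- \<omega> v x) y \<in> Z"
      using Z_component[of v] by simp
    then show ?thesis unfolding span_breakdown_eq Z by blast
  qed
  then have "span (insert x (insert y Z)) = UNIV" by auto
  then have "dim (UNIV :: 'b set) = dim (insert x (insert y Z))" by (metis dim_span)
  then show ?thesis
    using dim_insert_finitely_spanned[OF assms x] dim_insert_finitely_spanned[OF assms y] by simp
qed

end

theorem theorem1:
  fixes scale :: "'k::field \<Rightarrow> 'l::ab_group_add \<Rightarrow> 'l"
    and br :: "'l \<Rightarrow> 'l \<Rightarrow> 'l"
    and \<omega> :: "'l \<Rightarrow> 'l \<Rightarrow> 'k"
  assumes "CHAR('k) \<noteq> 2" and "CHAR('k) \<noteq> 3"
    and "omega_lie_algebra scale br \<omega>"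
    and "\<exists>B. finite B \<and> module.span scale B = UNIV"
    and "\<not> lie_algebra scale br"
  shows "(vector_space.dim scale (UNIV :: 'l set) = 3
      \<or> (\<exists>M. anticommutative_algebra.lie_subalgebra scale br M
            \<and> vector_space.dim scale (UNIV :: 'l set) = vector_space.dim scale M + 1
            \<and> (anticommutative_algebra.structure_a scale br M
               \<or> anticommutative_algebra.structure_b scale br M
               \<or> anticommutative_algebra.structure_c scale br M
               \<or> anticommutative_algebra.structure_d scale br M))
      \<or> (\<exists>H. anticommutative_algebra.almost_abelian scale br (form_kernel \<omega>) H
            \<and> vector_space.dim scale (UNIV :: 'l set) = vector_space.dim scale (form_kernel \<omega>) + 2
            \<and> (\<forall>h\<in>H. anticommutative_algebra.nilpotent_map (anticommutative_algebra.ad br h))))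
    \<and> (\<exists>A. anticommutative_algebra.abelian_subalgebra scale br A
          \<and> vector_space.dim scale (UNIV :: 'l set) \<le> vector_space.dim scale A + 3)"
proof -
  have "CHAR('k) \<noteq> 1" using CHAR_not_1[where ?'a = 'k] by simp
  moreover have "n = 1 \<or> n = 2" if "n dvd 2" for n :: nat
    using that dvd_imp_le[OF that] by (cases "n = 0") auto
  moreover have "n = 1 \<or> n = 3" if "n dvd 3" for n :: nat
    using that dvd_imp_le[OF that] by (cases "n = 0 \<or> n = 2") auto
  ultimately have "\<not> CHAR('k) dvd 2" "\<not> CHAR('k) dvd 3"
    using assms(1,2) by blast+
  then have "of_nat 2 \<noteq> (0::'k)" "of_nat 3 \<noteq> (0::'k)"
    by (simp_all only: of_nat_eq_0_iff_char_dvd not_False_eq_True)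
  then have "omega_lie_algebra_char_not_2_3 scale br \<omega>"
    using assms(3) by (simp add: omega_lie_algebra_char_not_2_3_def omega_lie_algebra_char_not_2_3_axioms_def)
  then interpret L: omega_lie_algebra_char_not_2_3 scale br \<omega> .
  have "\<exists>u v. \<omega> u v \<noteq> 0"
  proof (rule ccontr)
    assume "\<not> (\<exists>u v. \<omega> u v \<noteq> 0)"
    then have "lie_algebra scale br"
      by unfold_locales (simp add: L.jacobian_isotropic)
    then show False using assms(5) by blast
  qed
  then obtain x v where "\<omega> x v \<noteq> 0" by blast
  then have "\<omega> x (scale (inverse (\<omega> x v)) v) = 1" by (simp add: L.omega_simps)
  then interpret hyperbolic_pair scale br \<omega> x "scale (inverse (\<omega> x v)) v"
    by unfold_locales
  have dim: "L.dim (UNIV :: 'l set) = L.dim Z + 2"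
    using assms(4) by (rule dim_UNIV_kernel)
  have Z: "L.span Z = Z" using L.subspace_form_kernel by (simp add: L.span_eq_iff)
  show ?thesis
  proof (cases "\<exists>z\<in>Z. f z \<noteq> 0")
    case True
    then obtain z where z: "z \<in> Z" "f z \<noteq> 0" by blast
    define H where "H = {h \<in> Z. f h = 0}"
    note H = almost_abelian_kernel[OF z, folded H_def]
    obtain w where w: "w \<notin> H" "Z = L.span (insert w H)" using H(3) by blast
    have "L.span H = H" using H(2)
      by (simp add: L.span_eq_iff L.abelian_subalgebra_def L.subalgebra_def)
    then have "w \<notin> L.span H" using w(1) by (simp only: not_False_eq_True)
    then have "L.dim Z = L.dim H + 1"
      using L.dim_insert_finitely_spanned[OF assms(4)] w(2) by simp
    moreover have "\<forall>h\<in>H. L.nilpotent_map (L.ad h)"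
      using ad_nilpotent[OF z] by (simp add: H_def)
    ultimately show ?thesis using H(1,2) dim by auto
  next
    case False
    then have ab: "\<forall>z\<in>Z. f z = 0" by blast
    have Z_abelian: "L.abelian_subalgebra Z"
      using lie_subalgebra_Z ab
      by (simp add: L.abelian_subalgebra_def L.lie_subalgebra_def br_Z)
    from abelian_kernel_dichotomy[OF ab] show ?thesis
    proof (elim disjE exE conjE)
      fix v assume v: "v \<notin> Z" "\<forall>z\<in>Z. br z v \<in> Z"
      have "v \<notin> L.span Z" using v(1) Z by (simp only: not_False_eq_True)
      then have "L.dim (L.span (insert v Z)) = L.dim Z + 1"
        using L.dim_insert_finitely_spanned[OF assms(4)] by simp
      then show ?thesis
        using structure_a_insert[OF ab v] Z_abelian dim by auto
    next
      fix z assume "z \<noteq> 0" "Z = L.span {z}"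
      then have "L.dim Z = 1"
        using L.dim_insert_finitely_spanned[OF assms(4), of z "{}"]
          L.dim_eq_card_independent[OF L.independent_empty] by simp
      then show ?thesis using Z_abelian dim by auto
    qed
  qed
qed

end
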